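(* Let $G$ be a graph with ${\rm diam}(G)=2$. The following statements are equivalent: (i) $G$ is an injectively fall $\chi_i(G)$-colorable graph; (ii) $G$ is an injectively fall colorable graph; (iii) there exists a matching $M$ in $G$ such that each edge of $M$ does not belong to a triangle, and every edge of $G$ incident with a vertex not in $V(M)$ lies in a triangle.
   Context: All graphs are finite and simple. An injective $k$-coloring function of a graph $G$ is a function $f:V(G)\to\{1,\dots,k\}$ such that no vertex $v$ is adjacent to two distinct vertices $u$ and $w$ with $f(u)=f(w)$ (adjacent vertices may receive the same color). The injective chromatic number $\chi_i(G)$ is the minimum $k$ for which $G$ admits an injective $k$-coloring function. An open packing in $G$ is a set $B\subseteq V(G)$ such that $N_G(u)\cap N_G(v)=\emptyset$ for any two distinct $u,v\in B$; it is maximal if adding any new vertex to it yields a set that is not an open packing. An injective fall coloring of $G$ is a partition of $V(G)$ into maximal open packings. $G$ is injectively fall colorable if it admits an injective fall coloring, and injectively fall $\chi_i(G)$-colorable if it admits an injective fall coloring with exactly $\chi_i(G)$ classes. A matching may be empty, and $V(M)$ denotes the set of end-vertices of the edges of $M$. *)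

theory Defs
  imports
    "Graph_Theory.Pair_Digraph"
    "Graph_Theory.Shortest_Path"
    "HOL-Library.Disjoint_Sets"
begin

text \<open>
  A finite simple graph is a \<open>pair_graph\<close>: a finite vertex set with a symmetric,
  irreflexive set of arcs. The two arcs \<open>(u, v)\<close> and \<open>(v, u)\<close> represent
  one edge, which is written \<open>{u, v}\<close> where undirected edges are needed.
\<close>

definition edges :: "'a pair_pre_digraph \<Rightarrow> 'a set set" where
  "edges G = {{u, v} |u v. (u, v) \<in> parcs G}"

definition neighborhood :: "'a pair_pre_digraph \<Rightarrow> 'a \<Rightarrow> 'a set" where
  "neighborhood G v = {u. (v, u) \<in> parcs G}"

text \<open>Distances are infinite between different components, so a disconnected graph has
  infinite diameter.\<close>

definition diameter :: "'a pair_pre_digraph \<Rightarrow> ereal" where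
  "diameter G = (SUP u\<in>pverts G. SUP v\<in>pverts G. wf_digraph.\<mu> (with_proj G) (\<lambda>_. 1) u v)"

definition injective_coloring :: "'a pair_pre_digraph \<Rightarrow> nat \<Rightarrow> ('a \<Rightarrow> nat) \<Rightarrow> bool" where
  "injective_coloring G k f \<longleftrightarrow>
     f ` pverts G \<subseteq> {1..k} \<and>
     \<not> (\<exists>v u w. (v, u) \<in> parcs G \<and> (v, w) \<in> parcs G \<and> u \<noteq> w \<and> f u = f w)"

definition injective_chromatic_number :: "'a pair_pre_digraph \<Rightarrow> nat" where
  "injective_chromatic_number G = (LEAST k. \<exists>f. injective_coloring G k f)"

definition open_packing :: "'a pair_pre_digraph \<Rightarrow> 'a set \<Rightarrow> bool" where
  "open_packing G B \<longleftrightarrow>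
     B \<subseteq> pverts G \<and>
     (\<forall>u\<in>B. \<forall>v\<in>B. u \<noteq> v \<longrightarrow> neighborhood G u \<inter> neighborhood G v = {})"

definition maximal_open_packing :: "'a pair_pre_digraph \<Rightarrow> 'a set \<Rightarrow> bool" where
  "maximal_open_packing G B \<longleftrightarrow>
     open_packing G B \<and> (\<forall>v\<in>pverts G - B. \<not> open_packing G (insert v B))"

definition injective_fall_coloring :: "'a pair_pre_digraph \<Rightarrow> 'a set set \<Rightarrow> bool" where
  "injective_fall_coloring G P \<longleftrightarrow>
     partition_on (pverts G) P \<and> (\<forall>B\<in>P. maximal_open_packing G B)"

definition injectively_fall_colorable :: "'a pair_pre_digraph \<Rightarrow> bool" where
  "injectively_fall_colorable G \<longleftrightarrow> (\<exists>P. injective_fall_coloring G P)"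

definition injectively_fall_k_colorable :: "'a pair_pre_digraph \<Rightarrow> nat \<Rightarrow> bool" where
  "injectively_fall_k_colorable G k \<longleftrightarrow> (\<exists>P. injective_fall_coloring G P \<and> card P = k)"

definition matching :: "'a pair_pre_digraph \<Rightarrow> 'a set set \<Rightarrow> bool" where
  "matching G M \<longleftrightarrow> M \<subseteq> edges G \<and> disjoint M"

definition in_triangle :: "'a pair_pre_digraph \<Rightarrow> 'a set \<Rightarrow> bool" where
  "in_triangle G e \<longleftrightarrow>
     (\<exists>u v w. e = {u, v} \<and> (u, v) \<in> parcs G \<and> (v, w) \<in> parcs G \<and> (w, u) \<in> parcs G)"

end

theory Submission
  imports Defs
begin

text \<open>
  In a graph of diameter 2, two distinct vertices have disjoint neighborhoods exactly when they
  are joined by an edge lying in no triangle. Hence no three vertices have pairwise disjoint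
  neighborhoods, open packings have at most two elements, and a fall coloring is a matching of triangle-free
  edges together with singletons that no such edge meets. Counting each vertex on a
  triangle-free edge with weight 1 and every other vertex with weight 2, each class of a fall
  coloring has weight 2 and each class of an injective coloring has weight at most 2, so a fall
  coloring uses the fewest colors.
\<close>

text \<open>Diameter at most 2 is stated through common neighbors, so that no distances or walks
  occur in the combinatorial part.\<close>

locale diameter_le_two_graph = pair_graph G for G :: "'a pair_pre_digraph" +
  assumes adjacent_or_common_neighbor:
    "\<lbrakk>u \<in> pverts G; v \<in> pverts G; u \<noteq> v\<rbrakk> \<Longrightarrow>
      (u, v) \<in> parcs G \<or> neighborhood G u \<inter> neighborhood G v \<noteq> {}"
begin

section \<open>Open packings and triangle-free edges\<close>

lemma arc_sym: "(u, v) \<in> parcs G \<Longrightarrow> (v, u) \<in> parcs G"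
  using arcs_symmetric by blast

lemma in_triangle_iff:
  assumes "(u, v) \<in> parcs G"
  shows "in_triangle G {u, v} \<longleftrightarrow> neighborhood G u \<inter> neighborhood G v \<noteq> {}"
proof
  assume "in_triangle G {u, v}"
  then show "neighborhood G u \<inter> neighborhood G v \<noteq> {}"
    unfolding in_triangle_def neighborhood_def by (auto simp: doubleton_eq_iff intro: arc_sym)
next
  assume "neighborhood G u \<inter> neighborhood G v \<noteq> {}"
  then obtain w where "(u, w) \<in> parcs G" "(v, w) \<in> parcs G"
    by (auto simp: neighborhood_def)
  with assms show "in_triangle G {u, v}"
    unfolding in_triangle_def using arc_sym by blast
qed

text \<open>Disjoint neighborhoods rule out the second alternative of
  \<open>adjacent_or_common_neighbor\<close>. The distance hypothesis enters the later arguments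
  only through this fact.\<close>

lemma open_packing_arc:
  assumes "open_packing G B" "u \<in> B" "v \<in> B" "u \<noteq> v"
  shows "(u, v) \<in> parcs G"
  using assms adjacent_or_common_neighbor unfolding open_packing_def by blast

text \<open>By \<open>open_packing_arc\<close> a third member would be adjacent to both
  \<open>u\<close> and \<open>v\<close>, hence a common neighbor of two members.\<close>

lemma open_packing_eq_pair:
  assumes B: "open_packing G B" and uv: "u \<in> B" "v \<in> B" "u \<noteq> v"
  shows "B = {u, v}"
proof (rule ccontr)
  assume "B \<noteq> {u, v}"
  with uv obtain w where w: "w \<in> B" "w \<noteq> u" "w \<noteq> v" by blast
  with B uv have "w \<in> neighborhood G u \<inter> neighborhood G v"
    using open_packing_arc unfolding neighborhood_def by blast
  with B uv show False unfolding open_packing_def by blast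
qed

lemma open_packing_cases:
  assumes "open_packing G B" "B \<noteq> {}"
  obtains (single) u where "u \<in> pverts G" "B = {u}"
  | (pair) u v where "u \<noteq> v" "B = {u, v}" "(u, v) \<in> parcs G" "\<not> in_triangle G {u, v}"
proof -
  obtain u where u: "u \<in> B" using assms by blast
  show thesis
  proof (cases "B = {u}")
    case True
    then show thesis using assms single by (auto simp: open_packing_def)
  next
    case False
    with u obtain v where v: "v \<in> B" "u \<noteq> v" by blast
    have arc: "(u, v) \<in> parcs G" using open_packing_arc assms u v by blast
    moreover have "\<not> in_triangle G {u, v}"
      using in_triangle_iff[OF arc] assms u v unfolding open_packing_def by blast
    ultimately show thesis using pair open_packing_eq_pair assms u v by blast
  qed
qed

lemma open_packing_singleton: "v \<in> pverts G \<Longrightarrow> open_packing G {v}"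
  by (simp add: open_packing_def)

lemma open_packing_pair:
  assumes "(u, v) \<in> parcs G" "\<not> in_triangle G {u, v}"
  shows "open_packing G {u, v}"
proof -
  have "u \<in> pverts G" "v \<in> pverts G" using assms in_arcsD1 in_arcsD2 by auto
  with in_triangle_iff[OF assms(1)] assms(2) show ?thesis
    by (auto simp: open_packing_def)
qed

text \<open>Adding a third vertex is impossible, since \<open>open_packing_eq_pair\<close> bounds
  the size of every open packing by two.\<close>

lemma maximal_open_packing_pair:
  assumes "(u, v) \<in> parcs G" "\<not> in_triangle G {u, v}"
  shows "maximal_open_packing G {u, v}"
  unfolding maximal_open_packing_def
proof (intro conjI ballI notI)
  show "open_packing G {u, v}" using assms by (rule open_packing_pair)
next
  fix w assume w: "w \<in> pverts G - {u, v}" and "open_packing G (insert w {u, v})"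
  moreover have "u \<noteq> v" using assms(1) no_loops' by blast
  ultimately have "insert w {u, v} = {u, v}" by (intro open_packing_eq_pair) auto
  with w show False by blast
qed

text \<open>\<open>{v}\<close> can be enlarged by exactly those vertices that are joined to
  \<open>v\<close> by a triangle-free edge.\<close>

lemma maximal_open_packing_singleton_iff:
  assumes "v \<in> pverts G"
  shows "maximal_open_packing G {v} \<longleftrightarrow> (\<forall>u. (u, v) \<in> parcs G \<longrightarrow> in_triangle G {u, v})"
proof
  assume max: "maximal_open_packing G {v}"
  show "\<forall>u. (u, v) \<in> parcs G \<longrightarrow> in_triangle G {u, v}"
  proof (intro allI impI, rule ccontr)
    fix u assume arc: "(u, v) \<in> parcs G" and "\<not> in_triangle G {u, v}"
    then have "open_packing G {u, v}" by (rule open_packing_pair)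
    moreover have "u \<in> pverts G - {v}" using arc in_arcsD1 no_loops' by auto
    ultimately show False using max unfolding maximal_open_packing_def by blast
  qed
next
  assume tri: "\<forall>u. (u, v) \<in> parcs G \<longrightarrow> in_triangle G {u, v}"
  show "maximal_open_packing G {v}"
    unfolding maximal_open_packing_def
  proof (intro conjI ballI notI)
    show "open_packing G {v}" using assms by (rule open_packing_singleton)
  next
    fix u assume u: "u \<in> pverts G - {v}" and pack: "open_packing G {u, v}"
    then have arc: "(u, v) \<in> parcs G" using open_packing_arc by blast
    with tri have "in_triangle G {u, v}" by blast
    with pack u show False
      unfolding in_triangle_iff[OF arc] open_packing_def by blast
  qed
qed

section \<open>Counting classes by weight\<close>

definition weight :: "'a \<Rightarrow> nat" where
  "weight v = (if maximal_open_packing G {v} then 2 else 1)"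

text \<open>\<open>weight\<close> is defined by maximality of the singleton. A triangle-free edge at
  \<open>v\<close> destroys that maximality, which links the definition to the count by
  edges.\<close>

lemma weight_pair:
  assumes "(u, v) \<in> parcs G" "\<not> in_triangle G {u, v}"
  shows "weight v = 1"
proof -
  have "v \<in> pverts G" using assms in_arcsD2 by auto
  then show ?thesis using assms maximal_open_packing_singleton_iff by (auto simp: weight_def)
qed

lemma sum_weight_pair:
  assumes "(u, v) \<in> parcs G" "\<not> in_triangle G {u, v}"
  shows "sum weight {u, v} = 2"
proof -
  have "u \<noteq> v" using assms(1) no_loops' by blast
  moreover have "weight v = 1" using assms by (rule weight_pair)
  moreover have "weight u = 1"
    using weight_pair[of v u] assms arc_sym by (simp add: insert_commute)
  ultimately show ?thesis by simp
qed

lemma sum_weight_open_packing: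
  assumes "open_packing G B"
  shows "sum weight B \<le> 2"
proof (cases "B = {}")
  case False
  from assms this show ?thesis
  proof (cases rule: open_packing_cases)
    case single
    then show ?thesis by (simp add: weight_def)
  next
    case pair
    then show ?thesis using sum_weight_pair by (metis order_refl)
  qed
qed simp

lemma sum_weight_maximal_open_packing:
  assumes "maximal_open_packing G B" "B \<noteq> {}"
  shows "sum weight B = 2"
proof -
  have "open_packing G B" using assms by (simp add: maximal_open_packing_def)
  from this assms(2) show ?thesis
  proof (cases rule: open_packing_cases)
    case single
    with assms show ?thesis by (simp add: weight_def)
  next
    case pair
    then show ?thesis using sum_weight_pair by metis
  qed
qed

text \<open>The total weight does not depend on \<open>P\<close>, so all fall colorings have equally
  many classes.\<close>

lemma sum_weight_fall_coloring:
  assumes "injective_fall_coloring G P"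
  shows "sum weight (pverts G) = 2 * card P"
proof -
  have part: "partition_on (pverts G) P" and max: "\<And>B. B \<in> P \<Longrightarrow> maximal_open_packing G B"
    using assms by (auto simp: injective_fall_coloring_def)
  have "sum weight (\<Union>P) = (\<Sum>B\<in>P. sum weight B)"
  proof (subst sum.Union_disjoint)
    show "\<forall>B\<in>P. finite B"
      using part finite_subset[OF _ finite_verts] unfolding partition_on_def by auto
    show "\<forall>A\<in>P. \<forall>B\<in>P. A \<noteq> B \<longrightarrow> A \<inter> B = {}"
      using partition_onD2[OF part] by (auto simp: disjoint_def)
  qed simp
  also have "\<dots> = (\<Sum>B\<in>P. 2)"
    using max sum_weight_maximal_open_packing partition_onD3[OF part]
    by (intro sum.cong) auto
  finally show ?thesis using partition_onD1[OF part] by simp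
qed

lemma sum_weight_injective_coloring:
  assumes "injective_coloring G k f"
  shows "sum weight (pverts G) \<le> 2 * k"
proof -
  \<comment> \<open>Two vertices of one color with a common neighbor would violate injectivity of
    the coloring at that neighbor.\<close>
  have packing: "open_packing G {v \<in> pverts G. f v = c}" for c
    using assms arc_sym unfolding injective_coloring_def open_packing_def neighborhood_def
    by blast
  have "sum weight (pverts G) = (\<Sum>c\<in>{1..k}. sum weight {v \<in> pverts G. f v = c})"
    using assms finite_verts by (intro sum.group[symmetric]) (auto simp: injective_coloring_def)
  also have "\<dots> \<le> (\<Sum>c\<in>{1..k}. 2)"
    by (intro sum_mono sum_weight_open_packing packing)
  finally show ?thesis by simp
qed

lemma injective_coloring_of_fall_coloring:
  assumes "injective_fall_coloring G P"
  obtains f where "injective_coloring G (card P) f"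
proof -
  have part: "partition_on (pverts G) P" and pack: "\<And>B. B \<in> P \<Longrightarrow> open_packing G B"
    using assms by (auto simp: injective_fall_coloring_def maximal_open_packing_def)
  have "finite P" using finite_elements[OF finite_verts part] .
  \<comment> \<open>A color is obtained by sending a vertex to its class with \<open>b\<close> and
    numbering the classes with \<open>h\<close>.\<close>
  then obtain h where h: "bij_betw h P {1..card P}"
    using finite_same_card_bij[of P "{1..card P}"] by auto
  have "\<forall>v\<in>pverts G. \<exists>B\<in>P. v \<in> B" using partition_onD1[OF part] by blast
  then obtain b where b: "\<And>v. v \<in> pverts G \<Longrightarrow> b v \<in> P \<and> v \<in> b v" by metis
  have "injective_coloring G (card P) (h \<circ> b)"
    unfolding injective_coloring_def
  proof (intro conjI notI)
    show "(h \<circ> b) ` pverts G \<subseteq> {1..card P}"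
      using b h by (auto simp: bij_betw_def)
  next
    assume "\<exists>v u w. (v, u) \<in> parcs G \<and> (v, w) \<in> parcs G \<and> u \<noteq> w \<and> (h \<circ> b) u = (h \<circ> b) w"
    then obtain v u w where arcs: "(v, u) \<in> parcs G" "(v, w) \<in> parcs G" and "u \<noteq> w"
      and eq: "h (b u) = h (b w)" by auto
    have verts: "u \<in> pverts G" "w \<in> pverts G" using arcs in_arcsD2 by auto
    then have "b u = b w" using eq b h by (auto simp: bij_betw_def inj_on_def)
    with verts b have "u \<in> b u" "w \<in> b u" "b u \<in> P" by metis+
    with pack \<open>u \<noteq> w\<close> have "neighborhood G u \<inter> neighborhood G w = {}"
      unfolding open_packing_def by blast
    with arcs show False using arc_sym by (auto simp: neighborhood_def)
  qed
  then show thesis by (rule that)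
qed

text \<open>Numbering the classes gives a coloring with \<open>card P\<close> colors. Conversely, an
  injective coloring with \<open>k\<close> colors gives \<open>2 * card P \<le> 2 * k\<close> by
  comparing total weights.\<close>

lemma card_fall_coloring:
  assumes "injective_fall_coloring G P"
  shows "card P = injective_chromatic_number G"
  unfolding injective_chromatic_number_def
proof (rule Least_equality[symmetric])
  show "\<exists>f. injective_coloring G (card P) f"
    using injective_coloring_of_fall_coloring[OF assms] by blast
next
  fix k assume "\<exists>f. injective_coloring G k f"
  then show "card P \<le> k"
    using sum_weight_injective_coloring sum_weight_fall_coloring[OF assms] by fastforce
qed

section \<open>Fall colorings and matchings of triangle-free edges\<close>

lemma matching_of_fall_coloring:
  assumes "injective_fall_coloring G P"
  defines "M \<equiv> P \<inter> edges G"
  shows "matching G M" "\<forall>e\<in>M. \<not> in_triangle G e"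
    "\<forall>e\<in>edges G. (\<exists>v\<in>e. v \<notin> \<Union>M) \<longrightarrow> in_triangle G e"
proof -
  have part: "partition_on (pverts G) P" and max: "\<And>B. B \<in> P \<Longrightarrow> maximal_open_packing G B"
    using assms by (auto simp: injective_fall_coloring_def)
  \<comment> \<open>\<open>M\<close> collects the two-element classes, so its disjointness is
    inherited from the partition.\<close>
  show "matching G M"
    using partition_onD2[OF part] unfolding M_def matching_def disjoint_def by blast
  show "\<forall>e\<in>M. \<not> in_triangle G e"
  proof
    fix e assume e: "e \<in> M"
    then obtain u v where uv: "e = {u, v}" "(u, v) \<in> parcs G" by (auto simp: M_def edges_def)
    then have "u \<noteq> v" using no_loops' by blast
    moreover have "open_packing G e" using e max by (simp add: M_def maximal_open_packing_def)
    ultimately have "neighborhood G u \<inter> neighborhood G v = {}"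
      using uv unfolding open_packing_def by blast
    then show "\<not> in_triangle G e" using uv in_triangle_iff by blast
  qed
  show "\<forall>e\<in>edges G. (\<exists>v\<in>e. v \<notin> \<Union>M) \<longrightarrow> in_triangle G e"
  proof (intro ballI impI, elim bexE)
    fix e v assume e: "e \<in> edges G" and v: "v \<in> e" "v \<notin> \<Union>M"
    then obtain u where u: "e = {u, v}" "(u, v) \<in> parcs G"
      using arc_sym by (auto simp: edges_def)
    then have vG: "v \<in> pverts G" using in_arcsD2 by auto
    then obtain B where B: "B \<in> P" "v \<in> B" using partition_onD1[OF part] by blast
    then have "open_packing G B" "B \<noteq> {}" using max by (auto simp: maximal_open_packing_def)
    \<comment> \<open>A two-element class would be an edge, hence in \<open>M\<close>, and would
      cover \<open>v\<close>. Maximality of the singleton then puts every edge at \<open>v\<close>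
      in a triangle.\<close>
    then have "B = {v}"
    proof (cases rule: open_packing_cases)
      case single
      with B show ?thesis by simp
    next
      case pair
      then have "B \<in> edges G" by (auto simp: edges_def)
      with B v show ?thesis by (auto simp: M_def)
    qed
    with max B vG u show "in_triangle G e"
      using maximal_open_packing_singleton_iff by blast
  qed
qed

text \<open>The converse construction: the edges of \<open>M\<close> become the pairs, the uncovered
  vertices the singletons. \<open>free\<close> makes the pairs maximal open packings,
  \<open>tri\<close> the singletons.\<close>

lemma fall_coloring_of_matching:
  assumes M: "matching G M" and free: "\<forall>e\<in>M. \<not> in_triangle G e"
    and tri: "\<forall>e\<in>edges G. (\<exists>v\<in>e. v \<notin> \<Union>M) \<longrightarrow> in_triangle G e"
  shows "injective_fall_coloring G (M \<union> (\<lambda>v. {v}) ` (pverts G - \<Union>M))"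
    (is "injective_fall_coloring G ?P")
  unfolding injective_fall_coloring_def
proof (intro conjI ballI)
  have edge: "\<exists>u v. e = {u, v} \<and> (u, v) \<in> parcs G" if "e \<in> M" for e
    using M that by (auto simp: matching_def edges_def)
  have sub: "e \<subseteq> pverts G" "e \<noteq> {}" if "e \<in> M" for e
    using edge[OF that] in_arcsD1 in_arcsD2 by auto
  show "partition_on (pverts G) ?P"
  proof (rule partition_onI)
    show "\<Union>?P = pverts G" using sub by auto
    show "{} \<notin> ?P" using sub by auto
    show "disjnt A B" if "A \<in> ?P" "B \<in> ?P" "A \<noteq> B" for A B
      using that M unfolding matching_def disjoint_def disjnt_def by auto
  qed
next
  fix B assume "B \<in> ?P"
  then consider "B \<in> M" | v where "v \<in> pverts G" "v \<notin> \<Union>M" "B = {v}" by blast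
  then show "maximal_open_packing G B"
  proof cases
    case 1
    then obtain u v where "B = {u, v}" "(u, v) \<in> parcs G"
      using M by (auto simp: matching_def edges_def)
    with 1 free show ?thesis using maximal_open_packing_pair by blast
  next
    case 2
    then have "in_triangle G {u, v}" if "(u, v) \<in> parcs G" for u
      using that tri by (auto simp: edges_def)
    with 2 show ?thesis using maximal_open_packing_singleton_iff by blast
  qed
qed

end

section \<open>From the diameter to walks of at most two arcs\<close>

lemma diameter_le_two_graph:
  assumes "pair_graph G" "diameter G \<le> 2"
  shows "diameter_le_two_graph G"
proof -
  interpret pair_graph G by fact
  show ?thesis
  proof
    fix u v assume uv: "u \<in> pverts G" "v \<in> pverts G" "u \<noteq> v"
    have "\<mu> (\<lambda>_. 1) u v \<le> (SUP v\<in>pverts G. \<mu> (\<lambda>_. 1) u v)"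
      using uv by (intro SUP_upper)
    also have "\<dots> \<le> diameter G"
      unfolding diameter_def using uv by (intro SUP_upper)
    also have "\<dots> \<le> 2" by fact
    \<comment> \<open>A strict bound on the infimum yields an actual walk below it. Since costs are
      whole numbers, below 3 means at most 2.\<close>
    also have "\<dots> < (3 :: ereal)" by simp
    finally obtain p where p: "awalk u p v" "awalk_cost (\<lambda>_. 1) p < 3"
      unfolding \<mu>_def by (auto simp: INF_less_iff)
    have "length p < 3" using p(2) by (simp add: awalk_cost_def sum_list_triv)
    \<comment> \<open>\<open>remdups_adj.cases\<close> serves only to split lists into empty,
      one-element and longer ones.\<close>
    then consider "p = []" | a where "p = [a]" | a b where "p = [a, b]"
      by (cases p rule: remdups_adj.cases) auto
    then show "(u, v) \<in> parcs G \<or> neighborhood G u \<inter> neighborhood G v \<noteq> {}"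
    proof cases
      case 1
      with p uv show ?thesis by (simp add: awalk_empty_ends)
    next
      case 2
      with p show ?thesis by (auto simp: awalk_Cons_iff awalk_Nil_iff)
    next
      case 3
      \<comment> \<open>The head of the first arc is the middle vertex of the walk.\<close>
      with p have "(u, snd a) \<in> parcs G" "(snd a, v) \<in> parcs G"
        by (cases a; cases b; auto simp: awalk_Cons_iff awalk_Nil_iff)+
      then have "snd a \<in> neighborhood G u \<inter> neighborhood G v"
        using arcs_symmetric by (auto simp: neighborhood_def)
      then show ?thesis by blast
    qed
  qed
qed

theorem proposition14:
  fixes G :: "'a pair_pre_digraph"
  assumes "pair_graph G" and "diameter G = 2"
  shows
    "(injectively_fall_k_colorable G (injective_chromatic_number G) \<longleftrightarrow>
        injectively_fall_colorable G) \<and>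
     (injectively_fall_colorable G \<longleftrightarrow>
        (\<exists>M. matching G M \<and>
             (\<forall>e\<in>M. \<not> in_triangle G e) \<and>
             (\<forall>e\<in>edges G. (\<exists>v\<in>e. v \<notin> \<Union>M) \<longrightarrow> in_triangle G e)))"
proof -
  interpret diameter_le_two_graph G using assms by (simp add: diameter_le_two_graph)
  \<comment> \<open>Every fall coloring has \<open>injective_chromatic_number G\<close> classes,
    which gives the first equivalence. The two translations between colorings and matchings give the
    second.\<close>
  show ?thesis
    unfolding injectively_fall_colorable_def injectively_fall_k_colorable_def
    using card_fall_coloring matching_of_fall_coloring fall_coloring_of_matching by blast
qed

end
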